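(* (i) Let $w\in\mathbb{C}$ be fixed and let $z$ be fixed with $\mathrm{Re}(z)>0$. Let $\mathfrak{D}=\{x\in\mathbb{C}:|\arg x|<\frac{\pi}{4}\}$. Then as $x\to0$ along any path in $\mathfrak{D}$, $$K_{z,w}(x)\sim\frac12\Gamma(z)\left(\frac x2\right)^{-z}{}_1F_1\left(z;\frac12;-\frac{w^2}{4}\right).$$ (ii) Let $w\in\mathbb{C}$ be fixed and $|\arg x|<\frac{\pi}{4}$. As $x\to0$, $$K_{0,w}(x)\sim-\log x-\frac{w^2}{2}\,{}_2F_2\left(1,1;\frac32,2;-\frac{w^2}{4}\right).$$
   Context: The generalized modified Bessel function is defined, for $z,w\in\mathbb{C}$, by $$K_{z,w}(x):=\frac{1}{2\pi i}\int_{c-i\infty}^{c+i\infty}\Gamma\left(\tfrac{s-z}{2}\right)\Gamma\left(\tfrac{s+z}{2}\right)\,{}_1F_1\left(\tfrac{s-z}{2};\tfrac12;-\tfrac{w^2}{4}\right){}_1F_1\left(\tfrac{s+z}{2};\tfrac12;-\tfrac{w^2}{4}\right)2^{s-2}x^{-s}\,ds,$$ where $c=\mathrm{Re}(s)>|\mathrm{Re}(z)|$ and powers of $x$ and $\log x$ are principal. Here ${}_1F_1(a;c;u)=\sum_{n\ge0}\frac{(a)_n u^n}{(c)_n n!}$ and ${}_2F_2(a,b;c,d;u)=\sum_{n\ge0}\frac{(a)_n(b)_n u^n}{(c)_n(d)_n n!}$, with $(a)_n=a(a+1)\cdots(a+n-1)$. Meaning of $\sim$: in (i), $\left(\frac x2\right)^{z}K_{z,w}(x)\to\frac12\Gamma(z)\,{}_1F_1\left(z;\frac12;-\frac{w^2}{4}\right)$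 (equivalently, the ratio of the two sides tends to $1$ whenever this constant is nonzero); in (ii), the ratio of the two sides tends to $1$. *)

theory Defs
  imports "HOL-Analysis.Analysis"
begin

definition hyp_1F1 :: "complex \<Rightarrow> complex \<Rightarrow> complex \<Rightarrow> complex" where
  "hyp_1F1 a c u = (\<Sum>n. pochhammer a n * u ^ n / (pochhammer c n * fact n))"

definition hyp_2F2 :: "complex \<Rightarrow> complex \<Rightarrow> complex \<Rightarrow> complex \<Rightarrow> complex \<Rightarrow> complex" where
  "hyp_2F2 a b c d u =
     (\<Sum>n. pochhammer a n * pochhammer b n * u ^ n / (pochhammer c n * pochhammer d n * fact n))"

text \<open>
  The integral of \<open>f s ds\<close> over the upward vertical line from \<open>c - \<i>\<infinity>\<close> to \<open>c + \<i>\<infinity>\<close>, as a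
  Lebesgue integral with \<open>s = c + \<i> t\<close> and \<open>ds = \<i> dt\<close>.
\<close>
definition vertical_line_integral :: "real \<Rightarrow> (complex \<Rightarrow> complex) \<Rightarrow> complex" where
  "vertical_line_integral c f = (LINT t|lborel. f (Complex c t) * \<i>)"

text \<open>
  The generalized modified Bessel function, with the abscissa \<open>c\<close> of the line of integration
  as an explicit argument. The definition is meant for every \<open>c > \<bar>Re z\<bar>\<close>. Both \<open>powr\<close> are
  principal complex powers.
\<close>
definition gen_bessel_K :: "real \<Rightarrow> complex \<Rightarrow> complex \<Rightarrow> complex \<Rightarrow> complex" where
  "gen_bessel_K c z w x =
     1 / (2 * of_real pi * \<i>) *
     vertical_line_integral c (\<lambda>s.
       Gamma ((s - z) / 2) * Gamma ((s + z) / 2) *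
       hyp_1F1 ((s - z) / 2) (1 / 2) (- (w\<^sup>2 / 4)) *
       hyp_1F1 ((s + z) / 2) (1 / 2) (- (w\<^sup>2 / 4)) *
       2 powr (s - 2) * x powr (- s))"

text \<open>The condition \<open>x \<noteq> 0\<close> is needed because \<open>Arg 0 = 0\<close> in the library.\<close>
definition sector :: "complex set" where
  "sector = {x. x \<noteq> 0 \<and> \<bar>Arg x\<bar> < pi / 4}"

end

theory Submission
  imports Defs "HOL-Complex_Analysis.Complex_Analysis" "HOL-Probability.Sinc_Integral"
begin

text \<open>
  The function \<open>K\<^sub>z\<^sub>,\<^sub>w\<close> is an inverse Mellin transform, so its behaviour at the origin is dictated by the
  rightmost poles of its integrand. Moving the line of integration to the left across the first
  pole \<open>p\<close> expresses \<open>K\<close> as the residue at \<open>p\<close> plus an integral over a line \<open>Re s = a\<close> with \<open>a < Re p\<close>, and the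
  latter is \<open>O(\<bar>x\<bar> powr (- a))\<close> uniformly in the sector (\<open>gen_bessel_K_residue_expansion\<close>).

  For \<open>Re z > 0\<close> the first pole is a simple one at \<open>s = z\<close>, coming from \<open>\<Gamma>((s - z) / 2)\<close>; since
  \<open>\<^sub>1F\<^sub>1\<close> is 1 when its first parameter is 0, the residue is
  \<open>\<Gamma>(z) \<^sub>1F\<^sub>1(z; 1/2; - w\<^sup>2/4) (x/2) powr (- z) / 2\<close>. For \<open>z = 0\<close> two such poles merge at \<open>s = 0\<close> into a double
  one, whose residue is \<open>- Ln x\<close> plus a constant. The quotient in the second part therefore tends to 1
  whatever constant accompanies \<open>- Ln x\<close> in the denominator.

  The analytic input is that the integrand decays fast enough along vertical lines to beat
  \<open>x powr (- s)\<close>, which grows no faster than \<open>exp (\<pi>/4 \<bar>Im s\<bar>)\<close> in the sector. In vertical strips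
  the Gamma function decays like \<open>exp (- \<theta> \<bar>Im s\<bar>)\<close> for every \<open>\<theta> < \<pi>/2\<close> (\<open>Gamma_decay_strip\<close>). This
  needs no Stirling formula: the reflection formula gives the exact modulus on \<open>Re s = 1/2\<close>, the functional
  equation carries it to \<open>Re s = 1/2 + N\<close>, and the monotonicity of \<open>\<bar>\<Gamma>(\<sigma> + \<i> t)\<bar> / \<Gamma>(\<sigma>)\<close> in \<open>\<sigma>\<close> covers the
  lines in between. The confluent hypergeometric factors are entire in their first parameter \<open>a\<close> and
  \<open>O(exp (\<rho> \<bar>a\<bar>))\<close> for every \<open>\<rho> > 0\<close> (\<open>norm_hyp_1F1_le_exp\<close>), by comparison with a binomial series. Their
  product with the Gamma factors decays like \<open>exp (- \<bar>Im s\<bar>)\<close>, and \<open>1 > \<pi>/4\<close>.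
\<close>

section \<open>Exponential decay of the Gamma function in vertical strips\<close>

text \<open>
  For fixed \<open>t\<close> every quotient \<open>\<bar>\<sigma> + k + \<i> t\<bar> / (\<sigma> + k)\<close> decreases as \<open>\<sigma> > 0\<close> grows; the
  denominators are multiplied out.
\<close>
lemma norm_pochhammer_ratio_mono:
  fixes \<sigma> \<sigma>' t :: real
  assumes "0 < \<sigma>" "\<sigma> \<le> \<sigma>'"
  shows "norm (pochhammer (Complex \<sigma>' t) n) * pochhammer \<sigma> n
           \<le> norm (pochhammer (Complex \<sigma> t) n) * pochhammer \<sigma>' n"
proof -
  have "norm (Complex \<sigma>' t + of_nat k) * (\<sigma> + of_nat k)
          \<le> norm (Complex \<sigma> t + of_nat k) * (\<sigma>' + of_nat k)" for k :: nat
  proof (rule power2_le_imp_le)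
    have *: "norm (Complex r t + of_nat k) ^ 2 = (r + k)\<^sup>2 + t\<^sup>2" for r
      by (simp add: cmod_power2)
    have "(\<sigma> + k)\<^sup>2 \<le> (\<sigma>' + k)\<^sup>2"
      using assms by (intro power_mono) auto
    then have "t\<^sup>2 * (\<sigma> + k)\<^sup>2 \<le> t\<^sup>2 * (\<sigma>' + k)\<^sup>2"
      by (intro mult_left_mono) auto
    then show "(norm (Complex \<sigma>' t + of_nat k) * (\<sigma> + of_nat k))\<^sup>2
          \<le> (norm (Complex \<sigma> t + of_nat k) * (\<sigma>' + of_nat k))\<^sup>2"
      unfolding power_mult_distrib * by (simp add: algebra_simps)
  qed (use assms in auto)
  then show ?thesis
    using assms unfolding pochhammer_prod prod_norm[symmetric] prod.distrib[symmetric]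
    by (intro prod_mono) auto
qed

text \<open>
  The ratio \<open>\<bar>\<Gamma>(\<sigma> + \<i> t)\<bar> / \<Gamma>(\<sigma>)\<close> increases with \<open>\<sigma>\<close>, because in Gauss's limit formula the powers of
  \<open>n\<close> cancel from it and only quotients of Pochhammer symbols remain. This transports a bound from
  one vertical line to every line between it and the imaginary axis.
\<close>
lemma norm_Gamma_ratio_mono:
  fixes \<sigma> \<sigma>' t :: real
  assumes "0 < \<sigma>" "\<sigma> \<le> \<sigma>'"
  shows "norm (Gamma (Complex \<sigma> t)) * Gamma \<sigma>' \<le> norm (Gamma (Complex \<sigma>' t)) * Gamma \<sigma>"
proof (rule LIMSEQ_le)
  show "(\<lambda>n. norm (Gamma_series (Complex \<sigma> t) n) * Gamma_series \<sigma>' n)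
          \<longlonglongrightarrow> norm (Gamma (Complex \<sigma> t)) * Gamma \<sigma>'"
    by (intro tendsto_intros)
  show "(\<lambda>n. norm (Gamma_series (Complex \<sigma>' t) n) * Gamma_series \<sigma> n)
          \<longlonglongrightarrow> norm (Gamma (Complex \<sigma>' t)) * Gamma \<sigma>"
    by (intro tendsto_intros)
  have "norm (Gamma_series (Complex \<sigma> t) n) * Gamma_series \<sigma>' n
          \<le> norm (Gamma_series (Complex \<sigma>' t) n) * Gamma_series \<sigma> n" for n
  proof -
    have norm_eq: "norm (Gamma_series (Complex r t) n)
        = fact n * exp (r * ln n) / norm (pochhammer (Complex r t) (n + 1))" for r
      by (simp add: Gamma_series_def norm_divide norm_mult)
    have nz: "pochhammer (Complex r t) (n + 1) \<noteq> 0" if "r > 0" for r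
    proof -
      have "Complex r t \<noteq> - of_nat k" for k
        using that by (auto simp: complex_eq_iff)
      then show ?thesis by (auto simp: pochhammer_eq_0_iff)
    qed
    have pos: "pochhammer \<sigma> (n + 1) > 0" "pochhammer \<sigma>' (n + 1) > 0"
              "norm (pochhammer (Complex \<sigma> t) (n + 1)) > 0"
              "norm (pochhammer (Complex \<sigma>' t) (n + 1)) > 0"
      using assms nz by (auto intro!: pochhammer_pos simp del: pochhammer_Suc Suc_eq_plus1 add_Suc_right)
    have le: "1 / (norm (pochhammer (Complex \<sigma> t) (n + 1)) * pochhammer \<sigma>' (n + 1))
          \<le> 1 / (norm (pochhammer (Complex \<sigma>' t) (n + 1)) * pochhammer \<sigma> (n + 1))"
      using norm_pochhammer_ratio_mono[OF assms, of t "n + 1"] pos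
      by (intro divide_left_mono mult_pos_pos) auto
    have "(fact n * exp (\<sigma> * ln n)) * (fact n * exp (\<sigma>' * ln n)) *
            (1 / (norm (pochhammer (Complex \<sigma> t) (n + 1)) * pochhammer \<sigma>' (n + 1)))
       \<le> (fact n * exp (\<sigma> * ln n)) * (fact n * exp (\<sigma>' * ln n)) *
            (1 / (norm (pochhammer (Complex \<sigma>' t) (n + 1)) * pochhammer \<sigma> (n + 1)))"
      by (intro mult_left_mono le) auto
    then show ?thesis
      unfolding norm_eq unfolding Gamma_series_def by (simp add: mult_ac)
  qed
  then show "\<exists>N. \<forall>n\<ge>N. norm (Gamma_series (Complex \<sigma> t) n) * Gamma_series \<sigma>' n
          \<le> norm (Gamma_series (Complex \<sigma>' t) n) * Gamma_series \<sigma> n"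
    by blast
qed

text \<open>
  On the line \<open>Re s = 1/2\<close> the point \<open>1 - s\<close> is the conjugate of \<open>s\<close>, so the left side of the
  reflection formula is \<open>\<bar>\<Gamma>(s)\<bar>\<^sup>2\<close>.
\<close>
lemma norm_Gamma_critical_line: "norm (Gamma (Complex (1/2) t)) ^ 2 = pi / cosh (pi * t)"
proof -
  define s where "s = Complex (1/2) t"
  have "1 - s = cnj s" by (simp add: s_def complex_eq_iff)
  then have "Gamma s * cnj (Gamma s) = of_real pi / sin (of_real pi * s)"
    using Gamma_reflection_complex[of s] by (simp add: cnj_Gamma)
  moreover have "sin (of_real pi * s) = of_real (cosh (pi * t))"
  proof -
    have "of_real pi * s = of_real (pi / 2) + \<i> * of_real (pi * t)"
      by (simp add: s_def complex_eq_iff)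
    then have "sin (of_real pi * s) = cos (\<i> * of_real (pi * t))"
      by (simp add: sin_add flip: sin_of_real cos_of_real)
    also have "\<dots> = of_real (cosh (pi * t))"
      by (simp add: cos_exp_eq cosh_def exp_of_real scaleR_conv_of_real flip: exp_of_real mult.assoc)
    finally show ?thesis .
  qed
  ultimately have "Gamma s * cnj (Gamma s) = of_real (pi / cosh (pi * t))"
    by simp
  then have "of_real ((norm (Gamma s))\<^sup>2) = (of_real (pi / cosh (pi * t)) :: complex)"
    using complex_norm_square[of "Gamma s"] by simp
  then show ?thesis
    unfolding s_def of_real_eq_iff .
qed

lemma norm_Gamma_critical_line_le:
  "norm (Gamma (Complex (1/2) t)) \<le> sqrt (2 * pi) * exp (- (pi / 2 * \<bar>t\<bar>))"
proof (rule power2_le_imp_le)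
  have "exp (pi * \<bar>t\<bar>) \<le> 2 * cosh (pi * \<bar>t\<bar>)"
    by (simp add: cosh_def)
  also have "cosh (pi * \<bar>t\<bar>) = cosh (pi * t)"
    by (auto simp: abs_if cosh_minus)
  finally have "pi / cosh (pi * t) \<le> 2 * pi / exp (pi * \<bar>t\<bar>)"
    by (simp add: field_simps cosh_real_pos)
  also have "\<dots> = (sqrt (2 * pi) * exp (- (pi / 2 * \<bar>t\<bar>)))\<^sup>2"
    by (simp add: power_mult_distrib exp_minus field_simps flip: exp_double)
  finally show "(norm (Gamma (Complex (1/2) t)))\<^sup>2 \<le> (sqrt (2 * pi) * exp (- (pi / 2 * \<bar>t\<bar>)))\<^sup>2"
    by (simp add: norm_Gamma_critical_line)
qed auto

text \<open>
  Any power is absorbed by an arbitrarily slow exponential. The base is \<open>N + \<bar>t\<bar>\<close> with the exponent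
  \<open>N\<close> itself because this is the form in which Pochhammer symbols on the line \<open>Re s = 1/2\<close> are
  estimated.
\<close>
lemma power_add_abs_le_exp:
  fixes \<epsilon> :: real
  assumes "\<epsilon> > 0"
  shows "\<exists>C. \<forall>t. (of_nat N + \<bar>t\<bar>) ^ N \<le> C * exp (\<epsilon> * \<bar>t\<bar>)"
proof (cases "N = 0")
  case True
  then show ?thesis using assms by (intro exI[of _ 1]) auto
next
  case False
  have "(of_nat N + \<bar>t\<bar>) ^ N \<le> ((N / \<epsilon>) ^ N * exp (\<epsilon> * N)) * exp (\<epsilon> * \<bar>t\<bar>)" for t :: real
  proof -
    \<comment> \<open>Apply \<open>y \<le> exp y\<close> to an \<open>N\<close>-th part of the exponent and take \<open>N\<close>-th powers.\<close>
    define y where "y = \<epsilon> * (N + \<bar>t\<bar>) / N"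
    have "y \<le> exp y" using exp_ge_add_one_self[of y] by linarith
    then have "y ^ N \<le> exp y ^ N"
      using assms by (intro power_mono) (auto simp: y_def)
    also have "\<dots> = exp (\<epsilon> * N) * exp (\<epsilon> * \<bar>t\<bar>)"
      using False by (simp add: y_def flip: exp_of_nat_mult exp_add) (simp add: field_simps)
    finally have "(N / \<epsilon>) ^ N * y ^ N \<le> (N / \<epsilon>) ^ N * (exp (\<epsilon> * N) * exp (\<epsilon> * \<bar>t\<bar>))"
      using assms by (intro mult_left_mono) auto
    moreover have "(N / \<epsilon>) ^ N * y ^ N = (of_nat N + \<bar>t\<bar>) ^ N"
      using assms False unfolding power_mult_distrib[symmetric] by (simp add: y_def)
    ultimately show ?thesis by (simp add: mult_ac)
  qed
  then show ?thesis by blast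
qed

text \<open>
  The functional equation moves from \<open>Re s = 1/2\<close> to \<open>Re s = 1/2 + N\<close> at the price of a polynomial
  factor, which the gap between \<open>\<theta>\<close> and \<open>\<pi>/2\<close> absorbs.
\<close>
lemma Gamma_decay_half_integer_line:
  fixes N :: nat and \<theta> :: real
  assumes "\<theta> < pi / 2"
  shows "\<exists>C. \<forall>t. norm (Gamma (Complex (1/2 + N) t)) \<le> C * exp (- \<theta> * \<bar>t\<bar>)"
proof -
  obtain C where C: "\<And>t. (of_nat N + \<bar>t\<bar>) ^ N \<le> C * exp ((pi / 2 - \<theta>) * \<bar>t\<bar>)"
    using power_add_abs_le_exp[of "pi / 2 - \<theta>" N] assms by auto
  have "norm (Gamma (Complex (1/2 + N) t)) \<le> (C * sqrt (2 * pi)) * exp (- \<theta> * \<bar>t\<bar>)" for t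
  proof -
    define s where "s = Complex (1/2) t"
    have s: "s \<notin> \<int>\<^sub>\<le>\<^sub>0"
      by (auto simp: s_def complex_eq_iff elim!: nonpos_Ints_cases)
    have "s + of_nat N = Complex (1/2 + N) t"
      by (simp add: s_def complex_eq_iff)
    then have eq: "Gamma (Complex (1/2 + N) t) = pochhammer s N * Gamma s"
      using pochhammer_Gamma[OF s, of N] s by (simp add: Gamma_eq_zero_iff)
    have "norm (pochhammer s N) \<le> (\<Prod>k = 0..<N. of_nat N + \<bar>t\<bar>)"
      unfolding pochhammer_prod prod_norm[symmetric]
    proof (intro prod_mono conjI)
      fix k assume k: "k \<in> {0..<N}"
      have "norm (s + of_nat k) \<le> \<bar>Re (s + of_nat k)\<bar> + \<bar>Im (s + of_nat k)\<bar>"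
        by (rule cmod_le)
      also have "\<dots> = 1/2 + k + \<bar>t\<bar>"
        by (simp add: s_def)
      also have "\<dots> \<le> N + \<bar>t\<bar>"
        using k by auto
      finally show "norm (s + of_nat k) \<le> N + \<bar>t\<bar>" .
    qed auto
    also have "\<dots> = (of_nat N + \<bar>t\<bar>) ^ N" by simp
    also have "\<dots> \<le> C * exp ((pi / 2 - \<theta>) * \<bar>t\<bar>)" by (rule C)
    finally have "norm (pochhammer s N) * norm (Gamma s)
        \<le> (C * exp ((pi / 2 - \<theta>) * \<bar>t\<bar>)) * (sqrt (2 * pi) * exp (- (pi / 2 * \<bar>t\<bar>)))"
      using norm_Gamma_critical_line_le[of t]
      by (intro mult_mono) (auto simp: s_def intro: order_trans[OF norm_ge_zero])
    also have "\<dots> = (C * sqrt (2 * pi)) * (exp ((pi / 2 - \<theta>) * \<bar>t\<bar>) * exp (- (pi / 2 * \<bar>t\<bar>)))"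
      by simp
    also have "exp ((pi / 2 - \<theta>) * \<bar>t\<bar>) * exp (- (pi / 2 * \<bar>t\<bar>)) = exp (- \<theta> * \<bar>t\<bar>)"
      by (simp add: algebra_simps flip: exp_add)
    finally show ?thesis
      by (simp add: eq norm_mult)
  qed
  then show ?thesis by blast
qed

lemma norm_pochhammer_ge_1:
  assumes "\<bar>Im s\<bar> \<ge> 1"
  shows "norm (pochhammer s n) \<ge> 1"
proof -
  have "1 \<le> norm (s + of_nat k)" for k
    using assms abs_Im_le_cmod[of "s + of_nat k"] by simp
  then show ?thesis
    unfolding pochhammer_prod prod_norm[symmetric] by (intro prod_ge_1)
qed

text \<open>
  Away from the real axis, \<open>\<bar>\<Gamma>(s)\<bar> \<le> \<bar>\<Gamma>(s + n)\<bar>\<close> since each factor of the functional equation has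
  modulus at least 1. This moves the strip into \<open>Re s \<ge> 1\<close>, where monotonicity compares with a
  line \<open>Re s = 1/2 + N\<close> on its right.
\<close>
lemma Gamma_decay_strip:
  fixes \<sigma>0 \<sigma>1 \<theta> :: real
  assumes "\<theta> < pi / 2"
  shows "\<exists>C. \<forall>s. \<sigma>0 \<le> Re s \<and> Re s \<le> \<sigma>1 \<and> 1 \<le> \<bar>Im s\<bar>
            \<longrightarrow> norm (Gamma s) \<le> C * exp (- \<theta> * \<bar>Im s\<bar>)"
proof -
  obtain n :: nat where n: "1 - \<sigma>0 \<le> n" using real_arch_simple by blast
  obtain N :: nat where N: "\<sigma>1 + n \<le> N" using real_arch_simple by blast
  have "compact (Gamma ` {1..\<sigma>1 + n})"
    by (intro compact_continuous_image continuous_on_Gamma) (auto elim!: nonpos_Ints_cases)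
  then have "bounded (Gamma ` {1..\<sigma>1 + n})" by (rule compact_imp_bounded)
  then obtain M where M: "\<And>\<sigma>. 1 \<le> \<sigma> \<Longrightarrow> \<sigma> \<le> \<sigma>1 + n \<Longrightarrow> norm (Gamma \<sigma>) \<le> M"
    unfolding bounded_iff by (metis atLeastAtMost_iff imageI)
  obtain C where C: "\<And>t. norm (Gamma (Complex (1/2 + N) t)) \<le> C * exp (- \<theta> * \<bar>t\<bar>)"
    using Gamma_decay_half_integer_line[OF assms, of N] by auto
  have G: "Gamma (1/2 + N :: real) > 0" by (intro Gamma_real_pos) auto
  have "norm (Gamma s) \<le> C * M / Gamma (1/2 + N) * exp (- \<theta> * \<bar>Im s\<bar>)"
    if s: "\<sigma>0 \<le> Re s" "Re s \<le> \<sigma>1" "1 \<le> \<bar>Im s\<bar>" for s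
  proof -
    define \<sigma> where "\<sigma> = Re s + n"
    have \<sigma>: "1 \<le> \<sigma>" "\<sigma> \<le> \<sigma>1 + n" "\<sigma> \<le> 1/2 + N" using s n N by (auto simp: \<sigma>_def)
    have "s \<notin> \<int>\<^sub>\<le>\<^sub>0"
      using s by (auto elim!: nonpos_Ints_cases)
    moreover have "s + of_nat n = Complex \<sigma> (Im s)"
      by (simp add: \<sigma>_def complex_eq_iff)
    ultimately have "pochhammer s n * Gamma s = Gamma (Complex \<sigma> (Im s))"
      using pochhammer_Gamma[of s n] by (simp add: Gamma_eq_zero_iff)
    then have "norm (Gamma (Complex \<sigma> (Im s))) = norm (pochhammer s n) * norm (Gamma s)"
      by (metis norm_mult)
    then have "norm (Gamma s) \<le> norm (Gamma (Complex \<sigma> (Im s)))"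
      using mult_right_mono[OF norm_pochhammer_ge_1[OF s(3), of n], of "norm (Gamma s)"] by simp
    also have "\<dots> \<le> norm (Gamma (Complex (1/2 + N) (Im s))) * Gamma \<sigma> / Gamma (1/2 + N)"
      using norm_Gamma_ratio_mono[of \<sigma> "1/2 + N" "Im s"] \<sigma> G by (simp add: field_simps)
    also have "\<dots> \<le> C * exp (- \<theta> * \<bar>Im s\<bar>) * M / Gamma (1/2 + N)"
      using C[of "Im s"] M[OF \<sigma>(1,2)] G Gamma_real_pos[of \<sigma>] \<sigma>
      by (intro divide_right_mono mult_mono) (auto intro: order_trans[OF norm_ge_zero])
    finally show ?thesis by (simp add: mult_ac)
  qed
  then show ?thesis by blast
qed

section \<open>The confluent hypergeometric function in its first parameter\<close>

text \<open>
  Pochhammer symbols in the denominator beat every geometric sequence. This is what lets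
  a binomial series with small argument dominate \<open>\<^sub>1F\<^sub>1\<close> for any argument \<open>u\<close>.
\<close>
lemma power_div_pochhammer_bounded:
  fixes K c :: complex
  assumes "c \<notin> \<int>\<^sub>\<le>\<^sub>0"
  shows "\<exists>C. \<forall>n. norm (K ^ n / pochhammer c n) \<le> C"
proof -
  obtain N :: nat where N: "norm c + 2 * norm K \<le> N" using real_arch_simple by blast
  have "summable (\<lambda>n. K ^ n / pochhammer c n)"
  proof (rule summable_ratio_test[of "1/2" N])
    fix n assume n: "n \<ge> N"
    have "2 * norm K \<le> norm (c + of_nat n)"
      using norm_diff_ineq[of "of_nat n" c] N n by (simp add: add.commute)
    moreover have "c + of_nat n \<noteq> 0"
      using assms plus_of_nat_eq_0_imp by blast
    ultimately have "norm (K / (c + of_nat n)) \<le> 1/2"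
      by (simp add: norm_divide field_simps)
    then have "norm (K / (c + of_nat n)) * norm (K ^ n / pochhammer c n)
                  \<le> 1/2 * norm (K ^ n / pochhammer c n)"
      by (intro mult_right_mono) auto
    then show "norm (K ^ Suc n / pochhammer c (Suc n)) \<le> 1/2 * norm (K ^ n / pochhammer c n)"
      by (simp add: pochhammer_Suc norm_mult norm_divide mult_ac)
  qed auto
  then have "Bseq (\<lambda>n. K ^ n / pochhammer c n)"
    using summable_LIMSEQ_zero convergentI convergent_imp_Bseq by blast
  then show ?thesis by (auto simp: Bseq_def)
qed

lemma norm_pochhammer_le: "norm (pochhammer (a::complex) n) \<le> pochhammer (norm a) n"
  unfolding pochhammer_prod prod_norm[symmetric]
  by (intro prod_mono conjI order_trans[OF norm_triangle_ineq]) auto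

lemma pochhammer_mono: "0 \<le> x \<Longrightarrow> x \<le> y \<Longrightarrow> pochhammer x n \<le> pochhammer (y::real) n"
  unfolding pochhammer_prod by (intro prod_mono) auto

text \<open>
  The binomial series of \<open>(1 - \<epsilon>) powr (- A)\<close>, where \<open>\<epsilon> = 1 - exp (- \<rho>)\<close> is chosen so that the sum is
  \<open>exp (\<rho> A)\<close>.
\<close>
lemma sums_pochhammer_binomial:
  fixes \<rho> A :: real
  assumes "\<rho> > 0"
  shows "(\<lambda>n. pochhammer A n / fact n * (1 - exp (- \<rho>)) ^ n) sums exp (\<rho> * A)"
proof -
  define \<epsilon> where "\<epsilon> = 1 - exp (- \<rho>)"
  have \<epsilon>: "0 < \<epsilon>" "\<epsilon> < 1" using assms by (auto simp: \<epsilon>_def)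
  have "(\<lambda>n. ((- A) gchoose n) * (- \<epsilon>) ^ n) sums (1 + (- \<epsilon>)) powr (- A)"
    using \<epsilon> by (intro gen_binomial_real) auto
  moreover have "((- A) gchoose n) * (- \<epsilon>) ^ n = pochhammer A n / fact n * \<epsilon> ^ n" for n
  proof -
    have "(- \<epsilon>) ^ n = (- 1) ^ n * \<epsilon> ^ n" by (rule power_minus)
    then show ?thesis by (simp add: gbinomial_pochhammer)
  qed
  moreover have "(1 + (- \<epsilon>)) powr (- A) = exp (\<rho> * A)"
    by (simp add: \<epsilon>_def powr_def mult.commute)
  ultimately show ?thesis by (simp add: \<epsilon>_def)
qed

text \<open>
  Since \<open>(u / \<epsilon>) ^ n / (c)\<^sub>n\<close> is bounded, the series of \<open>\<^sub>1F\<^sub>1\<close> is dominated by a multiple of the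
  binomial series for any \<open>\<epsilon> > 0\<close>. The constant does not depend on \<open>a\<close>, so that this one estimate
  gives both the growth in \<open>a\<close> and local uniform convergence in \<open>a\<close>.
\<close>
lemma hyp_1F1_term_bound:
  fixes c u :: complex and \<rho> :: real
  assumes "c \<notin> \<int>\<^sub>\<le>\<^sub>0" "\<rho> > 0"
  shows "\<exists>C\<ge>0. \<forall>a n A. norm a \<le> A \<longrightarrow>
           norm (pochhammer a n * u ^ n / (pochhammer c n * fact n))
             \<le> C * (pochhammer A n / fact n * (1 - exp (- \<rho>)) ^ n)"
proof -
  define \<epsilon> where "\<epsilon> = 1 - exp (- \<rho>)"
  have \<epsilon>: "0 < \<epsilon>" using assms by (auto simp: \<epsilon>_def)
  obtain C where C: "\<And>n. norm ((u / of_real \<epsilon>) ^ n / pochhammer c n) \<le> C"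
    using power_div_pochhammer_bounded[OF assms(1), of "u / of_real \<epsilon>"] by auto
  have "C \<ge> 0" using C[of 0] by simp
  moreover have "norm (pochhammer a n * u ^ n / (pochhammer c n * fact n))
             \<le> C * (pochhammer A n / fact n * \<epsilon> ^ n)" if "norm a \<le> A" for a n A
  proof -
    have "norm (pochhammer a n * u ^ n / (pochhammer c n * fact n))
        = norm ((u / of_real \<epsilon>) ^ n / pochhammer c n) * (norm (pochhammer a n) / fact n * \<epsilon> ^ n)"
      using \<epsilon> by (simp add: norm_mult norm_divide norm_power power_divide)
    also have "\<dots> \<le> C * (pochhammer A n / fact n * \<epsilon> ^ n)"
    proof -
      have le: "norm (pochhammer a n) \<le> pochhammer A n"
        using norm_pochhammer_le[of a n] pochhammer_mono[of "norm a" A n] that by simp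
      then have "0 \<le> pochhammer A n" by (rule order_trans[OF norm_ge_zero])
      then show ?thesis
        using \<epsilon> C \<open>C \<ge> 0\<close> le by (intro mult_mono divide_right_mono) auto
    qed
    finally show ?thesis .
  qed
  ultimately show ?thesis unfolding \<epsilon>_def by blast
qed

text \<open>
  As a function of its first parameter, \<open>\<^sub>1F\<^sub>1\<close> grows more slowly than any exponential, so that it
  cannot spoil the decay of the Gamma function.
\<close>
lemma norm_hyp_1F1_le_exp:
  fixes c u :: complex and \<rho> :: real
  assumes "c \<notin> \<int>\<^sub>\<le>\<^sub>0" "\<rho> > 0"
  shows "\<exists>C\<ge>0. \<forall>a. norm (hyp_1F1 a c u) \<le> C * exp (\<rho> * norm a)"
proof -
  obtain C where C: "C \<ge> 0" "\<And>a n A. norm a \<le> A \<Longrightarrow>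
           norm (pochhammer a n * u ^ n / (pochhammer c n * fact n))
             \<le> C * (pochhammer A n / fact n * (1 - exp (- \<rho>)) ^ n)"
    using hyp_1F1_term_bound[OF assms, of u] by blast
  have "norm (hyp_1F1 a c u) \<le> C * exp (\<rho> * norm a)" for a
  proof -
    have sums: "(\<lambda>n. C * (pochhammer (norm a) n / fact n * (1 - exp (- \<rho>)) ^ n)) sums
            (C * exp (\<rho> * norm a))"
      by (intro sums_mult sums_pochhammer_binomial assms)
    show ?thesis
      unfolding hyp_1F1_def sums_unique[OF sums]
      by (intro norm_suminf_le C(2) sums_summable[OF sums] order_refl)
  qed
  with C(1) show ?thesis by blast
qed

lemma holomorphic_hyp_1F1:
  fixes c u :: complex
  assumes "c \<notin> \<int>\<^sub>\<le>\<^sub>0"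
  shows "(\<lambda>a. hyp_1F1 a c u) holomorphic_on A"
proof -
  obtain C where C: "C \<ge> 0" "\<And>a n A. norm a \<le> A \<Longrightarrow>
           norm (pochhammer a n * u ^ n / (pochhammer c n * fact n))
             \<le> C * (pochhammer A n / fact n * (1 - exp (- 1)) ^ n)"
    using hyp_1F1_term_bound[OF assms, of 1 u] by auto
  define f where "f = (\<lambda>n a. pochhammer a n * u ^ n / (pochhammer c n * fact n))"
  obtain g where g: "\<forall>a\<in>UNIV. ((\<lambda>n. f n a) sums g a) \<and> g field_differentiable (at a)"
  proof (rule series_differentiable_comparison_complex[of UNIV f])
    show "f n field_differentiable at x" for n x
      unfolding f_def pochhammer_prod
      by (intro holomorphic_on_imp_differentiable_at[of _ UNIV]) (auto intro!: holomorphic_intros)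
    show "\<exists>d (h :: nat \<Rightarrow> complex). 0 < d \<and> summable h \<and> range h \<subseteq> \<real>\<^sub>\<ge>\<^sub>0 \<and>
            (\<forall>\<^sub>F n in sequentially. \<forall>y\<in>ball x d \<inter> UNIV. norm (f n y) \<le> norm (h n))" for x
    proof -
      define h where "h = (\<lambda>n. C * (pochhammer (norm x + 1) n / fact n * (1 - exp (- 1)) ^ n))"
      have "summable h"
        unfolding h_def by (intro summable_mult sums_summable[OF sums_pochhammer_binomial]) auto
      then have "summable (\<lambda>n. complex_of_real (h n))" by (rule summable_of_real)
      moreover have h_nonneg: "h n \<ge> 0" for n
        using C(1) by (auto simp: h_def intro!: mult_nonneg_nonneg divide_nonneg_nonneg pochhammer_nonneg add_nonneg_pos)
      moreover have "norm (f n y) \<le> h n" if "y \<in> ball x 1" for n y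
      proof -
        have "norm y \<le> norm x + 1"
          using that norm_triangle_ineq2[of y x] by (auto simp: dist_norm norm_minus_commute)
        then show ?thesis unfolding f_def h_def by (rule C(2))
      qed
      ultimately show ?thesis
        by (intro exI[of _ 1] exI[of _ "\<lambda>n. complex_of_real (h n)"]) (auto simp: nonneg_Reals_of_real_iff)
    qed
  qed auto
  have "(\<lambda>a. hyp_1F1 a c u) = g"
  proof
    fix a
    have "(\<lambda>n. f n a) sums g a" using g by blast
    then show "hyp_1F1 a c u = g a" by (simp add: hyp_1F1_def f_def sums_iff)
  qed
  then show ?thesis
    using g by (auto simp: holomorphic_on_def intro: field_differentiable_at_within)
qed

lemma hyp_1F1_0 [simp]: "hyp_1F1 0 c u = 1"
proof -
  have "(\<lambda>n. pochhammer 0 n * u ^ n / (pochhammer c n * fact n)) sums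
          (\<Sum>n\<in>{0}. pochhammer 0 n * u ^ n / (pochhammer c n * fact n))"
    by (intro sums_finite) (auto simp: pochhammer_0_left)
  then show ?thesis
    unfolding hyp_1F1_def by (simp add: sums_iff)
qed

text \<open>
  Half of the gap \<open>\<pi>/2 - \<theta>\<close> is spent on the Gamma function and half on \<open>\<^sub>1F\<^sub>1\<close>.
\<close>
lemma Gamma_hyp_1F1_decay_strip:
  fixes \<sigma>0 \<sigma>1 \<theta> :: real and c v :: complex
  assumes "\<theta> < pi / 2" "c \<notin> \<int>\<^sub>\<le>\<^sub>0"
  shows "\<exists>C\<ge>0. \<forall>u. \<sigma>0 \<le> Re u \<and> Re u \<le> \<sigma>1 \<and> 1 \<le> \<bar>Im u\<bar>
            \<longrightarrow> norm (Gamma u * hyp_1F1 u c v) \<le> C * exp (- \<theta> * \<bar>Im u\<bar>)"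
proof -
  define \<rho> where "\<rho> = (pi / 2 - \<theta>) / 2"
  have \<rho>: "\<rho> > 0" "\<theta> + \<rho> < pi / 2" using assms(1) by (auto simp: \<rho>_def field_simps)
  obtain C1 where C1: "\<And>u. \<sigma>0 \<le> Re u \<Longrightarrow> Re u \<le> \<sigma>1 \<Longrightarrow> 1 \<le> \<bar>Im u\<bar>
            \<Longrightarrow> norm (Gamma u) \<le> C1 * exp (- (\<theta> + \<rho>) * \<bar>Im u\<bar>)"
    using Gamma_decay_strip[OF \<rho>(2), of \<sigma>0 \<sigma>1] by blast
  obtain C2 where C2: "C2 \<ge> 0" "\<And>u. norm (hyp_1F1 u c v) \<le> C2 * exp (\<rho> * norm u)"
    using norm_hyp_1F1_le_exp[OF assms(2) \<rho>(1), of v] by blast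
  define m where "m = max \<bar>\<sigma>0\<bar> \<bar>\<sigma>1\<bar>"
  have "norm (Gamma u * hyp_1F1 u c v) \<le> (\<bar>C1\<bar> * C2 * exp (\<rho> * m)) * exp (- \<theta> * \<bar>Im u\<bar>)"
    if u: "\<sigma>0 \<le> Re u" "Re u \<le> \<sigma>1" "1 \<le> \<bar>Im u\<bar>" for u
  proof -
    have "norm u \<le> m + \<bar>Im u\<bar>"
      using cmod_le[of u] u unfolding m_def by linarith
    then have "C2 * exp (\<rho> * norm u) \<le> C2 * exp (\<rho> * (m + \<bar>Im u\<bar>))"
      using \<rho> C2(1) by (intro mult_left_mono) auto
    with C2(2)[of u] have 2: "norm (hyp_1F1 u c v) \<le> C2 * exp (\<rho> * (m + \<bar>Im u\<bar>))"
      by linarith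
    have "C1 * exp (- (\<theta> + \<rho>) * \<bar>Im u\<bar>) \<le> \<bar>C1\<bar> * exp (- (\<theta> + \<rho>) * \<bar>Im u\<bar>)"
      by (intro mult_right_mono) auto
    with C1[OF u] have 1: "norm (Gamma u) \<le> \<bar>C1\<bar> * exp (- (\<theta> + \<rho>) * \<bar>Im u\<bar>)"
      by linarith
    have "norm (Gamma u * hyp_1F1 u c v)
        \<le> (\<bar>C1\<bar> * exp (- (\<theta> + \<rho>) * \<bar>Im u\<bar>)) * (C2 * exp (\<rho> * (m + \<bar>Im u\<bar>)))"
      unfolding norm_mult using C2(1) by (intro mult_mono 1 2) auto
    also have "\<dots> = (\<bar>C1\<bar> * C2 * exp (\<rho> * m)) * exp (- \<theta> * \<bar>Im u\<bar>)"
      by (simp add: algebra_simps flip: exp_add)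
    finally show ?thesis .
  qed
  moreover have "\<bar>C1\<bar> * C2 * exp (\<rho> * m) \<ge> 0" using C2(1) by auto
  ultimately show ?thesis by blast
qed

section \<open>Moving a vertical line of integration across a pole\<close>

lemma integrable_inverse_1_plus_square_lborel:
  "integrable lborel (\<lambda>t::real. inverse (1 + t\<^sup>2))"
  using integrable_inverse_1_plus_square by (simp add: set_integrable_def)

lemma bounded_by_inverse_square_of_decay:
  fixes g :: "real \<Rightarrow> complex"
  assumes "continuous_on UNIV g"
    and "\<And>t. \<bar>t\<bar> \<ge> T \<Longrightarrow> norm (g t) \<le> B * inverse (1 + t\<^sup>2)"
  shows "\<exists>B'. \<forall>t. norm (g t) \<le> B' * inverse (1 + t\<^sup>2)"
proof -
  have "compact ((\<lambda>t. (1 + t\<^sup>2) *\<^sub>R g t) ` {-T..T})"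
    by (intro compact_continuous_image continuous_intros continuous_on_subset[OF assms(1)]) auto
  then have "bounded ((\<lambda>t. (1 + t\<^sup>2) *\<^sub>R g t) ` {-T..T})"
    by (rule compact_imp_bounded)
  then obtain M where "\<forall>v\<in>(\<lambda>t. (1 + t\<^sup>2) *\<^sub>R g t) ` {-T..T}. norm v \<le> M"
    unfolding bounded_iff by blast
  then have M: "norm ((1 + t\<^sup>2) *\<^sub>R g t) \<le> M" if "\<bar>t\<bar> \<le> T" for t
    using that by (auto simp: abs_le_iff)
  have "norm (g t) \<le> max M B * inverse (1 + t\<^sup>2)" for t
  proof (cases "\<bar>t\<bar> \<le> T")
    case True
    have "1 + t\<^sup>2 > 0" by (simp add: add_pos_nonneg)
    then have "norm (g t) * (1 + t\<^sup>2) \<le> M"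
      using M[OF True] by (simp add: mult.commute)
    then show ?thesis
      using \<open>1 + t\<^sup>2 > 0\<close> by (simp add: field_simps)
  next
    case False
    then have "norm (g t) \<le> B * inverse (1 + t\<^sup>2)" using assms(2) by auto
    also have "\<dots> \<le> max M B * inverse (1 + t\<^sup>2)"
      by (intro mult_right_mono) auto
    finally show ?thesis .
  qed
  then show ?thesis by blast
qed

text \<open>
  Links Lebesgue integrals over a whole vertical line to contour integrals over segments. The
  segments end at \<open>Suc n\<close> rather than \<open>n\<close> to keep them nondegenerate.
\<close>
lemma linepath_integral_tendsto_vertical_line_integral:
  fixes f :: "complex \<Rightarrow> complex"
  assumes cont: "continuous_on UNIV (\<lambda>t. f (Complex r t))"
    and bound: "\<And>t. norm (f (Complex r t)) \<le> B * inverse (1 + t\<^sup>2)"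
  shows "(\<lambda>n. contour_integral (linepath (Complex r (- real (Suc n))) (Complex r (real (Suc n)))) f)
            \<longlonglongrightarrow> vertical_line_integral r f"
proof -
  \<comment> \<open>The factor \<open>\<i>\<close> is the velocity of the parametrisation \<open>s = r + \<i> t\<close>.\<close>
  define g where "g = (\<lambda>t. f (Complex r t) * \<i>)"
  have cont_g: "continuous_on UNIV g" unfolding g_def by (intro continuous_intros cont)
  then have [measurable]: "g \<in> borel_measurable borel"
    by (rule borel_measurable_continuous_onI)
  have "(\<lambda>n. LINT t|lborel. indicator {- real (Suc n)..real (Suc n)} t *\<^sub>R g t) \<longlonglongrightarrow> (LINT t|lborel. g t)"
  proof (rule integral_dominated_convergence)
    show "integrable lborel (\<lambda>t. B * inverse (1 + t\<^sup>2))"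
      by (intro integrable_mult_right integrable_inverse_1_plus_square_lborel)
    show "AE t in lborel. norm (indicator {- real (Suc n)..real (Suc n)} t *\<^sub>R g t) \<le> B * inverse (1 + t\<^sup>2)" for n
    proof (rule AE_I2)
      fix t :: real
      have "norm (indicator {- real (Suc n)..real (Suc n)} t *\<^sub>R g t) \<le> norm (f (Complex r t))"
        by (auto simp: g_def norm_mult indicator_def)
      then show "norm (indicator {- real (Suc n)..real (Suc n)} t *\<^sub>R g t) \<le> B * inverse (1 + t\<^sup>2)"
        using bound[of t] by linarith
    qed
    show "AE t in lborel. (\<lambda>n. indicator {- real (Suc n)..real (Suc n)} t *\<^sub>R g t) \<longlonglongrightarrow> g t"
    proof (rule AE_I2)
      fix t :: real
      obtain N :: nat where N: "\<bar>t\<bar> \<le> N" using real_arch_simple by blast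
      show "(\<lambda>n. indicator {- real (Suc n)..real (Suc n)} t *\<^sub>R g t) \<longlonglongrightarrow> g t"
      proof (rule tendsto_eventually, rule eventually_sequentiallyI[of N])
        fix n assume "n \<ge> N"
        then have "t \<in> {- real (Suc n)..real (Suc n)}" using N by auto
        then show "indicator {- real (Suc n)..real (Suc n)} t *\<^sub>R g t = g t" by simp
      qed
    qed
  qed auto
  moreover have "contour_integral (linepath (Complex r (- real (Suc n))) (Complex r (real (Suc n)))) f =
      (LINT t|lborel. indicator {- real (Suc n)..real (Suc n)} t *\<^sub>R g t)" for n
  proof -
    define m where "m = real (Suc n)"
    have "m > 0" by (simp add: m_def)
    have "set_integrable lborel {-m..m} g"
      by (intro borel_integrable_atLeastAtMost' continuous_on_subset[OF cont_g]) auto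
    then have "(g has_integral (LINT t:{-m..m}|lborel. g t)) {-m..m}"
      using set_borel_integral_eq_integral[of "{-m..m}" g] by (simp add: has_integral_integrable_integral)
    then have "((\<lambda>t. g t * (- \<i>)) has_integral ((LINT t:{-m..m}|lborel. g t) * (- \<i>))) {-m..m}"
      by (rule has_integral_mult_left)
    then have "((\<lambda>t. f (Complex r t)) has_integral (- \<i> * (LINT t:{-m..m}|lborel. g t))) {-m..m}"
      by (simp add: g_def mult_ac)
    then have "(f has_contour_integral (LINT t:{-m..m}|lborel. g t)) (linepath (Complex r (- m)) (Complex r m))"
      using \<open>m > 0\<close> by (subst has_contour_integral_linepath_same_Re_iff) auto
    then show ?thesis
      unfolding m_def[symmetric] using contour_integral_unique by (metis set_lebesgue_integral_def)
  qed
  ultimately show ?thesis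
    by (simp add: vertical_line_integral_def g_def)
qed

text \<open>
  The residue theorem on the rectangles with vertical sides on the two lines and horizontal sides at
  heights \<open>\<plusminus> Suc n\<close>, whose contributions vanish as \<open>n\<close> grows. The point \<open>p\<close> may be a pole of any
  order, which serves the simple and the double pole alike.
\<close>
lemma vertical_line_integral_shift:
  fixes f :: "complex \<Rightarrow> complex" and \<alpha> a b \<beta> T B :: real
  assumes ab: "\<alpha> < a" "a < Re p" "Re p < b" "b < \<beta>"
    and holo: "f holomorphic_on {s. \<alpha> < Re s \<and> Re s < \<beta>} - {p}"
    and decay: "\<And>s. a \<le> Re s \<Longrightarrow> Re s \<le> b \<Longrightarrow> T \<le> \<bar>Im s\<bar> \<Longrightarrow> norm (f s) \<le> B * inverse (1 + (Im s)\<^sup>2)"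
  shows "vertical_line_integral b f - vertical_line_integral a f = 2 * pi * \<i> * residue f p"
proof -
  define S where "S = {s. \<alpha> < Re s \<and> Re s < \<beta>}"
  have S: "open S" "convex S"
    unfolding S_def
    by (auto simp: Collect_conj_eq intro!: open_Int open_halfspace_Re_lt open_halfspace_Re_gt
          convex_Int convex_halfspace_Re_lt convex_halfspace_Re_gt)
  have open_Sp: "open (S - {p})" using S by auto
  have holo': "f holomorphic_on S - {p}" using holo by (simp add: S_def)
  have side: "\<exists>B'. (\<forall>t. norm (f (Complex r t)) \<le> B' * inverse (1 + t\<^sup>2))"
    and side_cont: "continuous_on UNIV (\<lambda>t. f (Complex r t))"
    if "r = a \<or> r = b" for r
  proof -
    show cont: "continuous_on UNIV (\<lambda>t. f (Complex r t))"
    proof (rule continuous_on_compose2[OF holomorphic_on_imp_continuous_on[OF holo']])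
      show "continuous_on UNIV (\<lambda>t. Complex r t)"
        unfolding Complex_eq by (intro continuous_intros)
    qed (use that ab in \<open>auto simp: S_def\<close>)
    show "\<exists>B'. (\<forall>t. norm (f (Complex r t)) \<le> B' * inverse (1 + t\<^sup>2))"
      by (rule bounded_by_inverse_square_of_decay[OF cont, of T B]) (use that ab decay[of "Complex r _"] in auto)
  qed
  have lim: "(\<lambda>n. contour_integral (linepath (Complex r (- real (Suc n))) (Complex r (real (Suc n)))) f)
            \<longlonglongrightarrow> vertical_line_integral r f" if r: "r = a \<or> r = b" for r
    using side[OF r] linepath_integral_tendsto_vertical_line_integral[OF side_cont[OF r]] by blast
  define bot where "bot n = contour_integral (linepath (Complex a (- real (Suc n))) (Complex b (- real (Suc n)))) f" for n
  define top where "top n = contour_integral (linepath (Complex b (real (Suc n))) (Complex a (real (Suc n)))) f" for n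
  \<comment> \<open>One estimate for the lower and the upper side, whatever their orientation.\<close>
  have horizontal: "(\<lambda>n. contour_integral (linepath (Complex x (y n)) (Complex x' (y n))) f) \<longlonglongrightarrow> 0"
    if x: "(x = a \<and> x' = b) \<or> (x = b \<and> x' = a)" and y: "\<And>n. \<bar>y n\<bar> = real (Suc n)" for x x' and y :: "nat \<Rightarrow> real"
  proof (rule Lim_null_comparison)
    define N where "N = nat \<lceil>max T \<bar>Im p\<bar>\<rceil>"
    have inv_lim: "(\<lambda>n. inverse (1 + (real (Suc n))\<^sup>2)) \<longlonglongrightarrow> 0"
      by real_asymp
    show "(\<lambda>n. \<bar>B\<bar> * inverse (1 + (real (Suc n))\<^sup>2) * (b - a)) \<longlonglongrightarrow> 0"
      by (rule tendsto_eq_intros inv_lim | simp)+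
    show "\<forall>\<^sub>F n in sequentially. norm (contour_integral (linepath (Complex x (y n)) (Complex x' (y n))) f)
            \<le> \<bar>B\<bar> * inverse (1 + (real (Suc n))\<^sup>2) * (b - a)"
    proof (rule eventually_sequentiallyI[of N])
      fix n assume "n \<ge> N"
      then have n: "T \<le> real (Suc n)" "\<bar>Im p\<bar> < real (Suc n)"
        unfolding N_def by linarith+
      have seg: "a \<le> Re s \<and> Re s \<le> b \<and> Im s = y n" if "s \<in> closed_segment (Complex x (y n)) (Complex x' (y n))" for s
        using that x ab closed_segment_same_Im[of "Complex x (y n)" "Complex x' (y n)"]
        by (auto simp: closed_segment_eq_real_ivl split: if_splits)
      have "norm (contour_integral (linepath (Complex x (y n)) (Complex x' (y n))) f)
              \<le> \<bar>B\<bar> * inverse (1 + (real (Suc n))\<^sup>2) * norm (Complex x' (y n) - Complex x (y n))"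
      proof (rule contour_integral_bound_linepath)
        show "f contour_integrable_on linepath (Complex x (y n)) (Complex x' (y n))"
        proof (rule contour_integrable_holomorphic_simple[OF holo' open_Sp])
          show "path_image (linepath (Complex x (y n)) (Complex x' (y n))) \<subseteq> S - {p}"
          proof
            fix s assume "s \<in> path_image (linepath (Complex x (y n)) (Complex x' (y n)))"
            then have "a \<le> Re s \<and> Re s \<le> b \<and> Im s = y n" using seg by simp
            moreover from this have "\<bar>Im s\<bar> = real (Suc n)" using y[of n] by simp
            ultimately show "s \<in> S - {p}" using n ab by (auto simp: S_def)
          qed
        qed auto
      next
        fix s assume "s \<in> closed_segment (Complex x (y n)) (Complex x' (y n))"
        then have s: "a \<le> Re s" "Re s \<le> b" "Im s = y n" using seg by auto
        have "norm (f s) \<le> B * inverse (1 + (Im s)\<^sup>2)"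
          using s y[of n] n by (intro decay) auto
        also have "(Im s)\<^sup>2 = (real (Suc n))\<^sup>2"
          using s y[of n] by (metis power2_abs)
        also have "B * inverse (1 + (real (Suc n))\<^sup>2) \<le> \<bar>B\<bar> * inverse (1 + (real (Suc n))\<^sup>2)"
          by (intro mult_right_mono) auto
        finally show "norm (f s) \<le> \<bar>B\<bar> * inverse (1 + (real (Suc n))\<^sup>2)" .
      qed auto
      also have "norm (Complex x' (y n) - Complex x (y n)) = b - a"
        using x ab by (auto simp: cmod_def)
      finally show "norm (contour_integral (linepath (Complex x (y n)) (Complex x' (y n))) f)
            \<le> \<bar>B\<bar> * inverse (1 + (real (Suc n))\<^sup>2) * (b - a)" .
    qed
  qed
  have bot: "bot \<longlonglongrightarrow> 0" and top: "top \<longlonglongrightarrow> 0"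
    unfolding bot_def top_def by (rule horizontal; simp)+
  have rect: "\<forall>\<^sub>F n in sequentially. bot n
        + contour_integral (linepath (Complex b (- real (Suc n))) (Complex b (real (Suc n)))) f + top n
        - contour_integral (linepath (Complex a (- real (Suc n))) (Complex a (real (Suc n)))) f
        = 2 * pi * \<i> * residue f p"
  proof (rule eventually_sequentiallyI[of "nat \<lceil>\<bar>Im p\<bar>\<rceil>"])
    fix n assume "n \<ge> nat \<lceil>\<bar>Im p\<bar>\<rceil>"
    then have n: "\<bar>Im p\<bar> < real (Suc n)" by linarith
    define m where "m = real (Suc n)"
    have m: "\<bar>Im p\<bar> < m" "0 < m" using n by (auto simp: m_def)
    define R where "R = rectpath (Complex a (- m)) (Complex b m)"
    have p_box: "p \<in> box (Complex a (- m)) (Complex b m)"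
      using ab m by (auto simp: in_box_complex_iff)
    have img: "path_image R \<subseteq> S - {p}"
      unfolding R_def using ab m by (subst path_image_rectpath) (auto simp: S_def)
    have pieces: "f contour_integrable_on linepath (Complex a (-m)) (Complex b (-m))"
         "f contour_integrable_on linepath (Complex b (-m)) (Complex b m)"
         "f contour_integrable_on linepath (Complex b m) (Complex a m)"
         "f contour_integrable_on linepath (Complex a m) (Complex a (-m))"
      using img unfolding R_def rectpath_def Let_def
      by (auto intro!: contour_integrable_holomorphic_simple[OF holo' open_Sp] simp: path_image_join)
    have "contour_integral R f = 2 * pi * \<i> * (\<Sum>q\<in>{p}. winding_number R q * residue f q)"
    proof (rule Residue_theorem[OF S(1) convex_connected[OF S(2)] _ holo'])
      show "path_image R \<subseteq> S - {p}" by (rule img)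
      show "\<forall>z. z \<notin> S \<longrightarrow> winding_number R z = 0"
        using S img by (auto intro!: winding_number_zero_outside[of _ S] simp: R_def)
    qed (auto simp: R_def)
    moreover have "winding_number R p = 1"
      unfolding R_def using p_box by (rule winding_number_rectpath)
    ultimately have "contour_integral R f = 2 * pi * \<i> * residue f p" by simp
    moreover have "contour_integral R f = contour_integral (linepath (Complex a (-m)) (Complex b (-m))) f
         + (contour_integral (linepath (Complex b (-m)) (Complex b m)) f
         + (contour_integral (linepath (Complex b m) (Complex a m)) f
         + contour_integral (linepath (Complex a m) (Complex a (-m))) f))"
      unfolding R_def rectpath_def Let_def using pieces by simp
    moreover have "contour_integral (linepath (Complex a m) (Complex a (-m))) f
        = - contour_integral (linepath (Complex a (-m)) (Complex a m)) f"
      using contour_integral_reversepath[of "linepath (Complex a (-m)) (Complex a m)" f] by simp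
    ultimately show "bot n
        + contour_integral (linepath (Complex b (- real (Suc n))) (Complex b (real (Suc n)))) f + top n
        - contour_integral (linepath (Complex a (- real (Suc n))) (Complex a (real (Suc n)))) f
        = 2 * pi * \<i> * residue f p"
      unfolding bot_def top_def m_def[symmetric] by (simp add: algebra_simps)
  qed
  have "(\<lambda>n. bot n
        + contour_integral (linepath (Complex b (- real (Suc n))) (Complex b (real (Suc n)))) f + top n
        - contour_integral (linepath (Complex a (- real (Suc n))) (Complex a (real (Suc n)))) f)
      \<longlonglongrightarrow> 0 + vertical_line_integral b f + 0 - vertical_line_integral a f"
    by (intro tendsto_add tendsto_diff lim bot top) auto
  then have "(\<lambda>n. 2 * pi * \<i> * residue f p) \<longlonglongrightarrow> 0 + vertical_line_integral b f + 0 - vertical_line_integral a f"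
    by (rule Lim_transform_eventually[OF _ rect])
  then show ?thesis
    by (simp add: tendsto_const_iff)
qed

section \<open>The Mellin--Barnes integrand and its residue expansion\<close>

text \<open>
  The part of the integrand that does not depend on \<open>x\<close>, that is, the Mellin transform of
  \<open>K\<^sub>z\<^sub>,\<^sub>w\<close>.
\<close>
definition bessel_mellin :: "complex \<Rightarrow> complex \<Rightarrow> complex \<Rightarrow> complex" where
  "bessel_mellin z w s =
     Gamma ((s - z) / 2) * Gamma ((s + z) / 2) *
     hyp_1F1 ((s - z) / 2) (1 / 2) (- (w\<^sup>2 / 4)) *
     hyp_1F1 ((s + z) / 2) (1 / 2) (- (w\<^sup>2 / 4)) * 2 powr (s - 2)"

lemma gen_bessel_K_eq_bessel_mellin:
  "gen_bessel_K c z w x =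
     1 / (2 * of_real pi * \<i>) * vertical_line_integral c (\<lambda>s. bessel_mellin z w s * x powr (- s))"
  by (simp add: gen_bessel_K_def bessel_mellin_def)

lemma half_not_nonpos_Int: "(1 / 2 :: complex) \<notin> \<int>\<^sub>\<le>\<^sub>0"
  by (auto simp: complex_eq_iff elim!: nonpos_Ints_cases)

text \<open>
  Each of the two factors \<open>\<Gamma> \<sqdot> \<^sub>1F\<^sub>1\<close> decays like \<open>exp (- \<bar>Im u\<bar>)\<close> at \<open>u = (s \<plusminus> z) / 2\<close>, and the two
  imaginary parts satisfy \<open>\<bar>Im (s - z)\<bar> / 2 + \<bar>Im (s + z)\<bar> / 2 \<ge> \<bar>Im s\<bar>\<close>. The rate 1 lies strictly
  between \<open>\<pi>/4\<close>, which the growth of \<open>x powr (- s)\<close> in the sector consumes, and the limit \<open>\<pi>/2\<close> set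
  by the Gamma function.
\<close>
lemma bessel_mellin_decay:
  fixes a b :: real
  shows "\<exists>C\<ge>0. \<forall>s. a \<le> Re s \<and> Re s \<le> b \<and> \<bar>Im z\<bar> + 2 \<le> \<bar>Im s\<bar>
            \<longrightarrow> norm (bessel_mellin z w s) \<le> C * exp (- \<bar>Im s\<bar>)"
proof -
  define G where "G = (\<lambda>u. Gamma u * hyp_1F1 u (1 / 2) (- (w\<^sup>2 / 4)))"
  have "(1::real) < pi / 2" using pi_gt3 by simp
  note G_decay = Gamma_hyp_1F1_decay_strip[OF this half_not_nonpos_Int, of _ _ "- (w\<^sup>2 / 4)"]
  obtain C1 where C1: "C1 \<ge> 0" "\<And>u. (a - Re z) / 2 \<le> Re u \<Longrightarrow> Re u \<le> (b - Re z) / 2 \<Longrightarrow> 1 \<le> \<bar>Im u\<bar>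
            \<Longrightarrow> norm (G u) \<le> C1 * exp (- 1 * \<bar>Im u\<bar>)"
    unfolding G_def using G_decay[of "(a - Re z) / 2" "(b - Re z) / 2"] by blast
  obtain C2 where C2: "C2 \<ge> 0" "\<And>u. (a + Re z) / 2 \<le> Re u \<Longrightarrow> Re u \<le> (b + Re z) / 2 \<Longrightarrow> 1 \<le> \<bar>Im u\<bar>
            \<Longrightarrow> norm (G u) \<le> C2 * exp (- 1 * \<bar>Im u\<bar>)"
    unfolding G_def using G_decay[of "(a + Re z) / 2" "(b + Re z) / 2"] by blast
  have "norm (bessel_mellin z w s) \<le> (C1 * C2 * 2 powr (b - 2)) * exp (- \<bar>Im s\<bar>)"
    if s: "a \<le> Re s" "Re s \<le> b" "\<bar>Im z\<bar> + 2 \<le> \<bar>Im s\<bar>" for s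
  proof -
    have im: "1 \<le> \<bar>Im ((s - z) / 2)\<bar>" "1 \<le> \<bar>Im ((s + z) / 2)\<bar>"
      using s(3) by auto
    have "norm (G ((s - z) / 2)) * norm (G ((s + z) / 2))
        \<le> (C1 * exp (- 1 * \<bar>Im ((s - z) / 2)\<bar>)) * (C2 * exp (- 1 * \<bar>Im ((s + z) / 2)\<bar>))"
      using s im C1(1) by (intro mult_mono C1(2) C2(2)) auto
    also have "\<dots> = C1 * C2 * exp (- (\<bar>Im ((s - z) / 2)\<bar> + \<bar>Im ((s + z) / 2)\<bar>))"
    proof -
      have "exp (- 1 * y) * exp (- 1 * y') = exp (- (y + y'))" for y y' :: real
        by (subst exp_add[symmetric]) simp
      then show ?thesis by (simp only: mult.assoc mult.left_commute)
    qed
    also have "\<dots> \<le> C1 * C2 * exp (- \<bar>Im s\<bar>)"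
    proof -
      have "\<bar>Im s\<bar> \<le> \<bar>Im ((s - z) / 2)\<bar> + \<bar>Im ((s + z) / 2)\<bar>"
        using abs_triangle_ineq[of "Im ((s - z) / 2)" "Im ((s + z) / 2)"]
        by (simp add: diff_divide_distrib add_divide_distrib)
      then show ?thesis using C1(1) C2(1) by (intro mult_left_mono) auto
    qed
    finally have GG: "norm (G ((s - z) / 2)) * norm (G ((s + z) / 2)) \<le> C1 * C2 * exp (- \<bar>Im s\<bar>)" .
    have "norm ((2 :: complex) powr (s - 2)) = 2 powr (Re s - 2)"
      using norm_powr_real_powr[of 2 "s - 2"] by simp
    also have "\<dots> \<le> 2 powr (b - 2)" using s by simp
    finally have "norm ((2 :: complex) powr (s - 2)) \<le> 2 powr (b - 2)" .
    then have "(norm (G ((s - z) / 2)) * norm (G ((s + z) / 2))) * norm ((2 :: complex) powr (s - 2))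
        \<le> (C1 * C2 * exp (- \<bar>Im s\<bar>)) * 2 powr (b - 2)"
      using C1(1) C2(1) by (intro mult_mono[OF GG]) auto
    then show ?thesis
      by (simp add: bessel_mellin_def G_def norm_mult mult_ac)
  qed
  moreover have "C1 * C2 * 2 powr (b - 2) \<ge> 0" using C1(1) C2(1) by auto
  ultimately show ?thesis by blast
qed

text \<open>
  Here the opening angle of the sector enters: it bounds the growth of \<open>x powr (- s)\<close> along vertical
  lines uniformly in \<open>x\<close>.
\<close>
lemma norm_powr_sector_le:
  assumes "x \<in> sector"
  shows "norm (x powr (- s)) \<le> norm x powr (- Re s) * exp (pi / 4 * \<bar>Im s\<bar>)"
proof -
  have x: "x \<noteq> 0" "\<bar>Arg x\<bar> \<le> pi / 4" using assms by (auto simp: sector_def)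
  have "norm (x powr (- s)) = exp (- Re s * ln (norm x)) * exp (Im s * Arg x)"
    using x by (simp add: powr_def Arg_eq_Im_Ln flip: exp_add)
  also have "exp (- Re s * ln (norm x)) = norm x powr (- Re s)"
    using x by (simp add: powr_def)
  also have "Im s * Arg x \<le> pi / 4 * \<bar>Im s\<bar>"
    using mult_mono[OF order_refl x(2), of "\<bar>Im s\<bar>"] abs_ge_self[of "Im s * Arg x"]
    by (simp add: abs_mult mult.commute)
  finally show ?thesis using x by simp
qed

lemma exp_decay_le_inverse_square:
  "\<exists>C\<ge>0. \<forall>t. exp (- \<bar>t\<bar>) * exp (pi / 4 * \<bar>t\<bar>) \<le> C * inverse (1 + t\<^sup>2)"
proof -
  have "pi < 4" using pi_less_4 .
  then obtain C where C: "\<And>t. (of_nat 2 + \<bar>t\<bar>) ^ 2 \<le> C * exp ((1 - pi / 4) * \<bar>t\<bar>)"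
    using power_add_abs_le_exp[of "1 - pi / 4" 2] by auto
  have "exp (- \<bar>t\<bar>) * exp (pi / 4 * \<bar>t\<bar>) \<le> C * inverse (1 + t\<^sup>2)" for t
  proof -
    have pos: "1 + t\<^sup>2 > 0" by (simp add: add_pos_nonneg)
    have "1 + t\<^sup>2 \<le> (2 + \<bar>t\<bar>) ^ 2"
      by (simp add: power2_eq_square algebra_simps)
    also have "\<dots> \<le> C * exp ((1 - pi / 4) * \<bar>t\<bar>)" using C[of t] by simp
    finally have "(1 + t\<^sup>2) * (exp (- \<bar>t\<bar>) * exp (pi / 4 * \<bar>t\<bar>))
        \<le> C * exp ((1 - pi / 4) * \<bar>t\<bar>) * (exp (- \<bar>t\<bar>) * exp (pi / 4 * \<bar>t\<bar>))"
      by (intro mult_right_mono) auto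
    also have "\<dots> = C"
      by (simp add: algebra_simps flip: exp_add)
    finally show ?thesis using pos by (simp add: field_simps)
  qed
  moreover have "C \<ge> 0"
    using C[of 0] by simp
  ultimately show ?thesis by blast
qed

text \<open>
  The decay that is left after the growth of \<open>x powr (- s)\<close> in the sector has been paid for. The
  majorant \<open>1 / (1 + t\<^sup>2)\<close> is integrable and makes the horizontal sides of rectangles vanish.
\<close>
lemma bessel_mellin_sector_decay:
  fixes a b :: real
  shows "\<exists>B\<ge>0. \<forall>s. a \<le> Re s \<and> Re s \<le> b \<and> \<bar>Im z\<bar> + 2 \<le> \<bar>Im s\<bar>
            \<longrightarrow> norm (bessel_mellin z w s) * exp (pi / 4 * \<bar>Im s\<bar>) \<le> B * inverse (1 + (Im s)\<^sup>2)"
proof -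
  obtain C where C: "C \<ge> 0" "\<And>s. a \<le> Re s \<Longrightarrow> Re s \<le> b \<Longrightarrow> \<bar>Im z\<bar> + 2 \<le> \<bar>Im s\<bar>
            \<Longrightarrow> norm (bessel_mellin z w s) \<le> C * exp (- \<bar>Im s\<bar>)"
    using bessel_mellin_decay[of a b z w] by blast
  obtain D where D: "D \<ge> 0" "\<And>t. exp (- \<bar>t\<bar>) * exp (pi / 4 * \<bar>t\<bar>) \<le> D * inverse (1 + t\<^sup>2)"
    using exp_decay_le_inverse_square by blast
  have "norm (bessel_mellin z w s) * exp (pi / 4 * \<bar>Im s\<bar>) \<le> (C * D) * inverse (1 + (Im s)\<^sup>2)"
    if s: "a \<le> Re s" "Re s \<le> b" "\<bar>Im z\<bar> + 2 \<le> \<bar>Im s\<bar>" for s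
  proof -
    have "norm (bessel_mellin z w s) * exp (pi / 4 * \<bar>Im s\<bar>)
        \<le> (C * exp (- \<bar>Im s\<bar>)) * exp (pi / 4 * \<bar>Im s\<bar>)"
      by (intro mult_right_mono C(2) s) auto
    also have "\<dots> = C * (exp (- \<bar>Im s\<bar>) * exp (pi / 4 * \<bar>Im s\<bar>))" by simp
    also have "\<dots> \<le> C * (D * inverse (1 + (Im s)\<^sup>2))"
      by (intro mult_left_mono C D)
    finally show ?thesis by simp
  qed
  moreover have "C * D \<ge> 0" using C(1) D(1) by auto
  ultimately show ?thesis by blast
qed

text \<open>
  The weight \<open>exp (\<pi>/4 \<bar>t\<bar>)\<close> in the hypothesis pays for \<open>x powr (- s)\<close>, so that the bound depends on
  \<open>x\<close> only through its modulus.
\<close>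
lemma norm_vertical_line_integral_sector_le:
  fixes h :: "complex \<Rightarrow> complex"
  assumes cont: "continuous_on UNIV (\<lambda>t. h (Complex a t))"
    and bound: "\<And>t. norm (h (Complex a t)) * exp (pi / 4 * \<bar>t\<bar>) \<le> B * inverse (1 + t\<^sup>2)"
    and x: "x \<in> sector"
  shows "norm (vertical_line_integral a (\<lambda>s. h s * x powr (- s)))
           \<le> (B * (LINT t|lborel. inverse (1 + t\<^sup>2))) * norm x powr (- a)"
proof -
  define g where "g = (\<lambda>t. h (Complex a t) * x powr (- Complex a t) * \<i>)"
  have "x \<noteq> 0" using x by (simp add: sector_def)
  then have "continuous_on UNIV g"
    unfolding g_def powr_def Complex_eq using cont
    by (auto simp: Complex_eq intro!: continuous_intros)
  then have [measurable]: "g \<in> borel_measurable borel"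
    by (rule borel_measurable_continuous_onI)
  have le: "norm (g t) \<le> (norm x powr (- a) * B) * inverse (1 + t\<^sup>2)" for t
  proof -
    have "norm (g t) \<le> norm (h (Complex a t)) * (norm x powr (- a) * exp (pi / 4 * \<bar>t\<bar>))"
      using norm_powr_sector_le[OF x, of "Complex a t"]
      by (simp add: g_def norm_mult mult_left_mono)
    also have "\<dots> = norm x powr (- a) * (norm (h (Complex a t)) * exp (pi / 4 * \<bar>t\<bar>))"
      by simp
    also have "\<dots> \<le> norm x powr (- a) * (B * inverse (1 + t\<^sup>2))"
      by (intro mult_left_mono bound) auto
    finally show ?thesis by simp
  qed
  have int: "integrable lborel (\<lambda>t. (norm x powr (- a) * B) * inverse (1 + t\<^sup>2))"
    by (intro integrable_mult_right integrable_inverse_1_plus_square_lborel)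
  have int_g: "integrable lborel g"
    by (rule Bochner_Integration.integrable_bound[OF int])
       (auto intro!: AE_I2 order_trans[OF le])
  have "norm (LINT t|lborel. g t) \<le> (LINT t|lborel. norm (g t))"
    by (rule integral_norm_bound)
  also have "\<dots> \<le> (LINT t|lborel. (norm x powr (- a) * B) * inverse (1 + t\<^sup>2))"
    by (intro integral_mono int integrable_norm int_g le)
  also have "\<dots> = (norm x powr (- a) * B) * (LINT t|lborel. inverse (1 + t\<^sup>2))"
    by (rule integral_mult_right_zero)
  finally show ?thesis
    by (simp add: vertical_line_integral_def g_def mult_ac)
qed

text \<open>
  Moving the line of integration from \<open>c\<close> to \<open>a < Re p\<close> picks up the residue at \<open>p\<close> and leaves an
  integral over the line \<open>Re s = a\<close>, to which the uniform bound for the sector applies.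
\<close>
lemma gen_bessel_K_residue_expansion:
  fixes \<alpha> a c \<beta> :: real
  assumes strip: "\<alpha> < a" "a < Re p" "Re p < c" "c < \<beta>"
    and holo: "bessel_mellin z w holomorphic_on {s. \<alpha> < Re s \<and> Re s < \<beta>} - {p}"
  shows "\<exists>B. \<forall>x\<in>sector. norm (gen_bessel_K c z w x
                - residue (\<lambda>s. bessel_mellin z w s * x powr (- s)) p) \<le> B * norm x powr (- a)"
proof -
  obtain B where B: "B \<ge> 0" "\<And>s. a \<le> Re s \<Longrightarrow> Re s \<le> c \<Longrightarrow> \<bar>Im z\<bar> + 2 \<le> \<bar>Im s\<bar>
            \<Longrightarrow> norm (bessel_mellin z w s) * exp (pi / 4 * \<bar>Im s\<bar>) \<le> B * inverse (1 + (Im s)\<^sup>2)"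
    using bessel_mellin_sector_decay[of a c z w] by blast
  have cont: "continuous_on UNIV (\<lambda>t. bessel_mellin z w (Complex a t))"
    by (rule continuous_on_compose2[OF holomorphic_on_imp_continuous_on[OF holo]])
       (use strip in \<open>auto simp: Complex_eq intro!: continuous_intros\<close>)
  have "\<exists>B'. \<forall>t. norm (bessel_mellin z w (Complex a t) * of_real (exp (pi / 4 * \<bar>t\<bar>)))
          \<le> B' * inverse (1 + t\<^sup>2)"
  proof (rule bounded_by_inverse_square_of_decay)
    show "continuous_on UNIV (\<lambda>t. bessel_mellin z w (Complex a t) * of_real (exp (pi / 4 * \<bar>t\<bar>)))"
      by (intro continuous_intros cont)
    show "norm (bessel_mellin z w (Complex a t) * of_real (exp (pi / 4 * \<bar>t\<bar>)))
            \<le> B * inverse (1 + t\<^sup>2)" if "\<bar>Im z\<bar> + 2 \<le> \<bar>t\<bar>" for t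
      using B(2)[of "Complex a t"] that strip by (simp add: norm_mult)
  qed
  then obtain B' where B': "\<And>t. norm (bessel_mellin z w (Complex a t)) * exp (pi / 4 * \<bar>t\<bar>)
          \<le> B' * inverse (1 + t\<^sup>2)"
    by (auto simp: norm_mult)
  define J where "J = (LINT t|lborel. inverse (1 + t\<^sup>2 :: real))"
  have "norm (gen_bessel_K c z w x - residue (\<lambda>s. bessel_mellin z w s * x powr (- s)) p)
          \<le> (B' * J / (2 * pi)) * norm x powr (- a)" if x: "x \<in> sector" for x
  proof -
    have x0: "x \<noteq> 0" using x by (simp add: sector_def)
    define f where "f = (\<lambda>s. bessel_mellin z w s * x powr (- s))"
    have "vertical_line_integral c f - vertical_line_integral a f = 2 * pi * \<i> * residue f p"
    proof (rule vertical_line_integral_shift[OF strip])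
      show "f holomorphic_on {s. \<alpha> < Re s \<and> Re s < \<beta>} - {p}"
        unfolding f_def powr_def using x0 holo by (auto intro!: holomorphic_intros)
      \<comment> \<open>For fixed \<open>x\<close> this majorises \<open>\<bar>x\<bar> powr (- Re s)\<close> on the whole strip, whether \<open>\<bar>x\<bar>\<close> is below or above 1.\<close>
      define M where "M = norm x powr (- a) + norm x powr (- c)"
      fix s assume s: "a \<le> Re s" "Re s \<le> c" "\<bar>Im z\<bar> + 2 \<le> \<bar>Im s\<bar>"
      have "norm x powr (- Re s) \<le> M"
      proof (cases "norm x \<le> 1")
        case True
        then have "norm x powr (- Re s) \<le> norm x powr (- c)"
          using s x0 by (intro powr_mono') auto
        then show ?thesis by (simp add: M_def add_increasing)
      next
        case False
        then have "norm x powr (- Re s) \<le> norm x powr (- a)"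
          using s by (intro powr_mono) auto
        then show ?thesis by (simp add: M_def add_increasing2)
      qed
      have "norm (f s) \<le> norm (bessel_mellin z w s) * (norm x powr (- Re s) * exp (pi / 4 * \<bar>Im s\<bar>))"
        unfolding f_def norm_mult by (intro mult_left_mono norm_powr_sector_le x) auto
      also have "\<dots> = norm x powr (- Re s) * (norm (bessel_mellin z w s) * exp (pi / 4 * \<bar>Im s\<bar>))"
        by simp
      also have "\<dots> \<le> M * (B * inverse (1 + (Im s)\<^sup>2))"
        using \<open>norm x powr (- Re s) \<le> M\<close> by (intro mult_mono B(2) s) (auto simp: M_def)
      finally show "norm (f s) \<le> (M * B) * inverse (1 + (Im s)\<^sup>2)" by simp
    qed
    then have eq: "gen_bessel_K c z w x - residue f p
        = 1 / (2 * of_real pi * \<i>) * vertical_line_integral a f"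
      by (simp add: gen_bessel_K_eq_bessel_mellin f_def field_simps)
    have "norm (vertical_line_integral a f) \<le> (B' * J) * norm x powr (- a)"
      unfolding f_def J_def by (rule norm_vertical_line_integral_sector_le[OF cont B' x])
    then show ?thesis
      unfolding f_def[symmetric] eq by (simp add: norm_mult norm_divide field_simps)
  qed
  then show ?thesis by blast
qed

section \<open>Residues at the leading pole\<close>

lemma holomorphic_hyp_1F1_compose [holomorphic_intros]:
  assumes "f holomorphic_on A" "c \<notin> \<int>\<^sub>\<le>\<^sub>0"
  shows "(\<lambda>s. hyp_1F1 (f s) c u) holomorphic_on A"
  using holomorphic_on_compose[OF assms(1) holomorphic_hyp_1F1[OF assms(2)]] by (simp add: o_def)

lemma complex_nonpos_IntD:
  fixes u :: complex
  assumes "u \<in> \<int>\<^sub>\<le>\<^sub>0"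
  shows "u = 0 \<or> Re u \<le> - 1" "Re u \<le> 0"
proof -
  obtain n where "n \<le> 0" "u = of_int n" using assms by (auto elim: nonpos_Ints_cases)
  then show "u = 0 \<or> Re u \<le> - 1" "Re u \<le> 0" by auto
qed

text \<open>
  Both sides vanish at the pole \<open>u = 0\<close>, by the convention for division by zero and for Gamma at its
  poles.
\<close>
lemma Gamma_eq_Gamma_plus1_div:
  fixes u :: complex
  assumes "Re u > - 1"
  shows "Gamma u = Gamma (u + 1) / u"
proof (cases "u = 0")
  case False
  then have "u \<notin> \<int>\<^sub>\<le>\<^sub>0" using complex_nonpos_IntD(1)[of u] assms by auto
  from Gamma_plus1[OF this] False show ?thesis by simp
qed auto

lemma holomorphic_bessel_mellin:
  assumes "\<And>s. s \<in> A \<Longrightarrow> (s - z) / 2 \<notin> \<int>\<^sub>\<le>\<^sub>0 \<and> (s + z) / 2 \<notin> \<int>\<^sub>\<le>\<^sub>0"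
  shows "bessel_mellin z w holomorphic_on A"
  unfolding bessel_mellin_def powr_def using assms
  by (auto intro!: holomorphic_intros half_not_nonpos_Int)

text \<open>
  For \<open>Re z > 0\<close> only the factor \<open>\<Gamma>((s - z) / 2) = 2 \<Gamma>((s - z) / 2 + 1) / (s - z)\<close> is singular at
  \<open>s = z\<close>, and the \<open>\<^sub>1F\<^sub>1\<close> with parameter \<open>(s - z) / 2\<close> equals 1 there.
\<close>
lemma residue_bessel_mellin_simple:
  assumes z: "Re z > 0" and x: "x \<noteq> 0"
  shows "residue (\<lambda>s. bessel_mellin z w s * x powr (- s)) z
           = 2 * Gamma z * hyp_1F1 z (1 / 2) (- (w\<^sup>2 / 4)) * 2 powr (z - 2) * x powr (- z)"
proof -
  define H where "H = (\<lambda>s. 2 * Gamma ((s - z) / 2 + 1) * Gamma ((s + z) / 2) *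
     hyp_1F1 ((s - z) / 2) (1 / 2) (- (w\<^sup>2 / 4)) *
     hyp_1F1 ((s + z) / 2) (1 / 2) (- (w\<^sup>2 / 4)) * 2 powr (s - 2) * x powr (- s))"
  define A where "A = {s. Re s > max (- Re z) (Re z - 2)}"
  have "open A" unfolding A_def by (rule open_halfspace_Re_gt)
  moreover have "z \<in> A" using z by (simp add: A_def)
  ultimately have A: "open A" "z \<in> A" by auto
  have "H holomorphic_on A"
    unfolding H_def powr_def using x
    by (auto intro!: holomorphic_intros half_not_nonpos_Int dest!: complex_nonpos_IntD(2) simp: A_def field_simps)
  then have "residue (\<lambda>s. H s / (s - z) ^ Suc 0) z = H z"
    using residue_holomorphic_over_power[OF A, of H 0] by simp
  moreover have "residue (\<lambda>s. bessel_mellin z w s * x powr (- s)) z = residue (\<lambda>s. H s / (s - z) ^ Suc 0) z"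
  proof (rule residue_cong)
    have "\<forall>\<^sub>F s in at z. s \<in> A" using A by (rule eventually_at_in_open')
    then show "\<forall>\<^sub>F s in at z. bessel_mellin z w s * x powr (- s) = H s / (s - z) ^ Suc 0"
    proof eventually_elim
      case (elim s)
      then have "Re ((s - z) / 2) > - 1" by (auto simp: A_def)
      from Gamma_eq_Gamma_plus1_div[OF this] show ?case
        by (simp add: bessel_mellin_def H_def)
    qed
  qed simp
  ultimately show ?thesis by (simp add: H_def)
qed

text \<open>
  For \<open>z = 0\<close> both Gamma factors have their pole at \<open>s = 0\<close>, and the residue is the derivative at 0 of
  \<open>h(s) x powr (- s)\<close> with \<open>h(0) = 1\<close>. The logarithm arises from differentiating the power of \<open>x\<close>.
  The constant \<open>\<kappa> = h'(0)\<close> is not computed because a bounded term does not affect the ratio with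
  \<open>- Ln x\<close>.
\<close>
lemma residue_bessel_mellin_double:
  "\<exists>\<kappa>. \<forall>x. x \<noteq> 0 \<longrightarrow> residue (\<lambda>s. bessel_mellin 0 w s * x powr (- s)) 0 = \<kappa> - Ln x"
proof -
  define h where "h = (\<lambda>s. 4 * (Gamma (s / 2 + 1) * hyp_1F1 (s / 2) (1 / 2) (- (w\<^sup>2 / 4)))\<^sup>2 * 2 powr (s - 2))"
  define A where "A = {s. Re s > - 2}"
  have A: "open A" "0 \<in> A" by (auto simp: A_def open_halfspace_Re_gt)
  have h_holo: "h holomorphic_on A"
    unfolding h_def powr_def
    by (auto intro!: holomorphic_intros half_not_nonpos_Int dest!: complex_nonpos_IntD(2) simp: A_def)
  have "(2 :: complex) powr (- 2) = 1 / 4"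
    using powr_of_int[of "2::complex" "- 2"] by (simp add: power_int_def field_simps)
  then have h0: "h 0 = 1" by (simp add: h_def mult.commute)
  have "residue (\<lambda>s. bessel_mellin 0 w s * x powr (- s)) 0 = deriv h 0 - Ln x" if x: "x \<noteq> 0" for x
  proof -
    define H where "H = (\<lambda>s. h s * x powr (- s))"
    have "H holomorphic_on A"
      unfolding H_def powr_def using x h_holo by (auto intro!: holomorphic_intros)
    then have "residue (\<lambda>s. H s / (s - 0) ^ Suc 1) 0 = deriv H 0"
      using residue_holomorphic_over_power[OF A, of H 1] by simp
    moreover have "residue (\<lambda>s. bessel_mellin 0 w s * x powr (- s)) 0 = residue (\<lambda>s. H s / (s - 0) ^ Suc 1) 0"
    proof (rule residue_cong)
      have "\<forall>\<^sub>F s in at 0. s \<in> A" using A by (rule eventually_at_in_open')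
      then show "\<forall>\<^sub>F s in at 0. bessel_mellin 0 w s * x powr (- s) = H s / (s - 0) ^ Suc 1"
      proof eventually_elim
        case (elim s)
        then have "Re (s / 2) > - 1" by (auto simp: A_def)
        from Gamma_eq_Gamma_plus1_div[OF this] show ?case
          by (simp add: bessel_mellin_def H_def h_def power2_eq_square)
      qed
    qed simp
    moreover have "deriv H 0 = deriv h 0 - Ln x"
    proof (rule DERIV_imp_deriv)
      have "(h has_field_derivative deriv h 0) (at 0)"
        using h_holo A holomorphic_derivI by blast
      then show "(H has_field_derivative deriv h 0 - Ln x) (at 0)"
        unfolding H_def powr_def using x h0 by (auto intro!: derivative_eq_intros)
    qed
    ultimately show ?thesis by simp
  qed
  then show ?thesis by blast
qed

section \<open>Behaviour at the origin\<close>

lemma norm_powr_tendsto_0_sector: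
  assumes "r > 0"
  shows "((\<lambda>x::complex. norm x powr r) \<longlongrightarrow> 0) (at 0 within A)"
proof -
  have "((\<lambda>x::complex. norm x) \<longlongrightarrow> 0) (at 0 within A)"
    by (intro tendsto_eq_intros) auto
  then have "((\<lambda>x::complex. norm x powr r) \<longlongrightarrow> 0 powr r) (at 0 within A)"
    by (rule tendsto_powr'[OF _ tendsto_const]) (use assms in auto)
  then show ?thesis by simp
qed

lemma eventually_sector: "\<forall>\<^sub>F x in at 0 within sector. x \<in> sector"
  by (auto simp: eventually_at_filter)

text \<open>
  The factor that turns the residue at \<open>s = z\<close> into the limit constant. The two logarithms satisfy
  \<open>Ln (x / 2) = Ln x - Ln 2\<close> since 2 is a positive real, so the branches of the powers match.
\<close>
lemma half_powr_mult_powr_minus: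
  fixes x z :: complex
  assumes "x \<noteq> 0"
  shows "(x / 2) powr z * (2 * 2 powr (z - 2) * x powr (- z)) = 1 / 2"
proof -
  have "Ln (x / 2) = Ln x - Ln 2"
    using Ln_divide_of_real[of 2 x] assms by (simp add: Ln_of_real[symmetric])
  then have "(x / 2) powr z * (2 powr (z - 2) * x powr (- z)) = exp (- (2 * Ln 2))"
    unfolding powr_def \<open>Ln (x / 2) = Ln x - Ln 2\<close> using assms
    by (simp add: algebra_simps flip: exp_add)
  also have "\<dots> = 1 / 4"
    by (simp add: exp_minus exp_double)
  finally show ?thesis by (simp add: algebra_simps)
qed

text \<open>
  The line is moved to \<open>Re s = Re z - d\<close>. As \<open>2 d = min (Re z) 1\<close>, the strip down to \<open>Re z - 2 d\<close>
  avoids the poles at \<open>- z - 2 k\<close> and at \<open>z - 2, z - 4, \<dots>\<close>, so that \<open>z\<close> is the only pole crossed and the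
  error after multiplication with \<open>(x / 2) powr z\<close> is of order \<open>\<bar>x\<bar> powr d\<close>.
\<close>
lemma gen_bessel_K_limit_Re_pos:
  assumes z: "Re z > 0" and c: "c > \<bar>Re z\<bar>"
  shows "((\<lambda>x. (x / 2) powr z * gen_bessel_K c z w x) \<longlongrightarrow>
            1 / 2 * Gamma z * hyp_1F1 z (1 / 2) (- (w\<^sup>2 / 4))) (at 0 within sector)"
    (is "(_ \<longlongrightarrow> ?L) _")
proof -
  define d where "d = min (Re z) 1 / 2"
  have d: "0 < d" "2 * d \<le> Re z" "2 * d \<le> 1" using z by (auto simp: d_def)
  have "bessel_mellin z w holomorphic_on {s. Re z - 2 * d < Re s \<and> Re s < c + 1} - {z}"
    by (rule holomorphic_bessel_mellin)
       (use d z in \<open>auto dest!: complex_nonpos_IntD(1) simp: add_eq_0_iff\<close>)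
  then obtain B where B: "\<And>x. x \<in> sector \<Longrightarrow> norm (gen_bessel_K c z w x
        - residue (\<lambda>s. bessel_mellin z w s * x powr (- s)) z) \<le> B * norm x powr (- (Re z - d))"
    using gen_bessel_K_residue_expansion[of "Re z - 2 * d" "Re z - d" z c "c + 1" z w] d c by auto
  have "((\<lambda>x. (x / 2) powr z * gen_bessel_K c z w x - ?L) \<longlongrightarrow> 0) (at 0 within sector)"
  proof (rule Lim_null_comparison)
    show "((\<lambda>x::complex. (2 powr (- Re z) * exp (\<bar>Im z\<bar> * pi) * B) * norm x powr d) \<longlongrightarrow> 0) (at 0 within sector)"
      by (rule tendsto_mult_right_zero[OF norm_powr_tendsto_0_sector[OF d(1)]])
    show "\<forall>\<^sub>F x in at 0 within sector. norm ((x / 2) powr z * gen_bessel_K c z w x - ?L)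
            \<le> (2 powr (- Re z) * exp (\<bar>Im z\<bar> * pi) * B) * norm x powr d"
      using eventually_sector
    proof eventually_elim
      case (elim x)
      then have x: "x \<noteq> 0" by (simp add: sector_def)
      define R where "R = residue (\<lambda>s. bessel_mellin z w s * x powr (- s)) z"
      have "(x / 2) powr z * R = ?L"
        using half_powr_mult_powr_minus[OF x, of z] unfolding R_def residue_bessel_mellin_simple[OF z x]
        by (simp add: algebra_simps)
      then have "norm ((x / 2) powr z * gen_bessel_K c z w x - ?L)
          = norm ((x / 2) powr z) * norm (gen_bessel_K c z w x - R)"
        by (metis norm_mult right_diff_distrib)
      also have "\<dots> \<le> (norm (x / 2) powr Re z * exp (\<bar>Im z\<bar> * pi)) * (B * norm x powr (- (Re z - d)))"
      proof (intro mult_mono)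
        show "norm (gen_bessel_K c z w x - R) \<le> B * norm x powr (- (Re z - d))"
          unfolding R_def by (rule B[OF elim])
        have "norm ((x / 2) powr z) = norm (x / 2) powr Re z * exp (- Im z * Arg (x / 2))"
          using x by (simp add: powr_def Arg_eq_Im_Ln flip: exp_add)
        also have "- Im z * Arg (x / 2) \<le> \<bar>Im z\<bar> * pi"
        proof -
          have "\<bar>Arg (x / 2)\<bar> \<le> pi"
            using Arg_le_pi[of "x / 2"] mpi_less_Arg[of "x / 2"] by linarith
          then have "\<bar>Im z\<bar> * \<bar>Arg (x / 2)\<bar> \<le> \<bar>Im z\<bar> * pi" by (intro mult_left_mono) auto
          then show ?thesis using abs_ge_self[of "- Im z * Arg (x / 2)"] by (simp add: abs_mult)
        qed
        finally show "norm ((x / 2) powr z) \<le> norm (x / 2) powr Re z * exp (\<bar>Im z\<bar> * pi)"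
          by (simp add: mult_left_mono)
      qed auto
      also have "\<dots> = (2 powr (- Re z) * exp (\<bar>Im z\<bar> * pi) * B) * (norm x powr Re z * norm x powr (- (Re z - d)))"
        using x by (simp add: norm_divide powr_divide powr_minus field_simps)
      also have "norm x powr Re z * norm x powr (- (Re z - d)) = norm x powr d"
        by (simp flip: powr_add)
      finally show ?case .
    qed
  qed
  then show ?thesis by (simp add: LIM_zero_iff)
qed

text \<open>
  Moving the line to \<open>Re s = - 1\<close>, between the double poles at 0 and \<open>- 2\<close>, gives
  \<open>K = - Ln x + \<kappa> + O(\<bar>x\<bar>)\<close>. As \<open>\<bar>Ln x\<bar>\<close> tends to infinity, the quotient tends to 1 for any constant
  \<open>\<mu>\<close>, in particular for the \<open>\<^sub>2F\<^sub>2\<close> term of the theorem.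
\<close>
lemma gen_bessel_K_limit_0:
  fixes \<mu> :: complex
  assumes c: "c > 0"
  shows "((\<lambda>x. gen_bessel_K c 0 w x / (- Ln x - \<mu>)) \<longlongrightarrow> 1) (at 0 within sector)"
proof -
  have "bessel_mellin 0 w holomorphic_on {s. - (3 / 2) < Re s \<and> Re s < c + 1} - {0}"
    by (rule holomorphic_bessel_mellin)
       (auto dest!: complex_nonpos_IntD(1))
  then obtain B where B: "\<And>x. x \<in> sector \<Longrightarrow> norm (gen_bessel_K c 0 w x
        - residue (\<lambda>s. bessel_mellin 0 w s * x powr (- s)) 0) \<le> B * norm x powr 1"
    using gen_bessel_K_residue_expansion[of "- (3 / 2)" "- 1" 0 c "c + 1" 0 w] c by auto
  obtain \<kappa> where \<kappa>: "\<And>x. x \<noteq> 0 \<Longrightarrow> residue (\<lambda>s. bessel_mellin 0 w s * x powr (- s)) 0 = \<kappa> - Ln x"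
    using residue_bessel_mellin_double[of w] by blast
  define E where "E = (\<lambda>x. gen_bessel_K c 0 w x - (\<kappa> - Ln x))"
  have "(E \<longlongrightarrow> 0) (at 0 within sector)"
  proof (rule Lim_null_comparison)
    show "((\<lambda>x::complex. B * norm x powr 1) \<longlongrightarrow> 0) (at 0 within sector)"
      by (rule tendsto_mult_right_zero[OF norm_powr_tendsto_0_sector]) auto
    show "\<forall>\<^sub>F x in at 0 within sector. norm (E x) \<le> B * norm x powr 1"
      using eventually_sector
    proof eventually_elim
      case (elim x)
      with B[OF this] \<kappa>[of x] show ?case by (simp add: E_def sector_def)
    qed
  qed
  then have num: "((\<lambda>x. \<kappa> + \<mu> + E x) \<longlongrightarrow> \<kappa> + \<mu> + 0) (at 0 within sector)"
    by (intro tendsto_intros)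
  have ln_inf: "filterlim (\<lambda>x::complex. - ln (norm x) - norm \<mu>) at_top (at 0 within sector)"
  proof -
    have "filterlim (\<lambda>x::complex. norm x) (at_right 0) (at 0 within sector)"
      unfolding filterlim_at
      by (auto simp: eventually_at_filter intro!: tendsto_eq_intros)
    moreover have "filterlim (\<lambda>r::real. - ln r - norm \<mu>) at_top (at_right 0)"
      by real_asymp
    ultimately show ?thesis by (rule filterlim_compose[rotated])
  qed
  have den: "filterlim (\<lambda>x. - Ln x - \<mu>) at_infinity (at 0 within sector)"
  proof (rule filterlim_norm_at_top_imp_at_infinity, rule filterlim_at_top_mono[OF ln_inf])
    show "\<forall>\<^sub>F x in at 0 within sector. - ln (norm x) - norm \<mu> \<le> norm (- Ln x - \<mu>)"
      using eventually_sector
    proof eventually_elim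
      case (elim x)
      then have "- ln (norm x) \<le> norm (- Ln x)"
        using abs_Re_le_cmod[of "- Ln x"] by (auto simp: sector_def)
      also have "\<dots> \<le> norm (- Ln x - \<mu>) + norm \<mu>"
        using norm_triangle_sub[of "- Ln x" \<mu>] by (simp add: add.commute)
      finally show ?case by simp
    qed
  qed
  have "((\<lambda>x. 1 + (\<kappa> + \<mu> + E x) / (- Ln x - \<mu>)) \<longlongrightarrow> 1 + 0) (at 0 within sector)"
    by (intro tendsto_add tendsto_const tendsto_divide_0[OF num den])
  moreover have "\<forall>\<^sub>F x in at 0 within sector.
      1 + (\<kappa> + \<mu> + E x) / (- Ln x - \<mu>) = gen_bessel_K c 0 w x / (- Ln x - \<mu>)"
  proof -
    have "\<forall>\<^sub>F x in at 0 within sector. - Ln x - \<mu> \<noteq> 0"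
      using filterlim_at_infinity_imp_eventually_ne[OF den] .
    then show ?thesis
      by eventually_elim (simp add: E_def field_simps)
  qed
  ultimately show ?thesis
    using Lim_transform_eventually by fastforce
qed

theorem theorem1p13:
  fixes w :: complex
  shows "(\<forall>(z::complex) (c::real). Re z > 0 \<longrightarrow> c > \<bar>Re z\<bar> \<longrightarrow>
            ((\<lambda>x. (x / 2) powr z * gen_bessel_K c z w x) \<longlongrightarrow>
               1 / 2 * Gamma z * hyp_1F1 z (1 / 2) (- (w\<^sup>2 / 4))) (at 0 within sector)) \<and>
         (\<forall>c::real. c > \<bar>Re (0::complex)\<bar> \<longrightarrow>
            ((\<lambda>x. gen_bessel_K c 0 w x /
               (- Ln x - w\<^sup>2 / 2 * hyp_2F2 1 1 (3 / 2) 2 (- (w\<^sup>2 / 4)))) \<longlongrightarrow> 1)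
              (at 0 within sector))"
  by (intro conjI allI impI gen_bessel_K_limit_Re_pos gen_bessel_K_limit_0) auto

end
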